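(* Let $k,n$ be positive integers and let $i$ be an integer with $0\le i<k$. Fix any choice of strip for $(k,n,i)$ (that is, any choice of which points of the upper boundary belong to the strip). Then the non-empty partitions of the set of good paths are exactly Partitions $i, i+1,\ldots,k$, and these all have the same size (number of good paths).
   Context: All paths are lattice paths in $\mathbb{Z}^2$ composed only of unit steps to the right $(1,0)$ and up $(0,1)$. Fix positive integers $k,n$ and an integer $i$ with $0\le i<k$. For a point $(x,y)$ let $d((x,y))=ky-x$, the signed horizontal distance from $(x,y)$ to the line $y=x/k$. The strip: it consists of all lattice points $p\notin\{(0,0),(kn-i,n)\}$ such that $0\le d(p)<i$, together with an arbitrary (chosen and fixed) subset of the lattice points $p\notin\{(0,0),(kn-i,n)\}$ on the upper boundary $d(p)=i$. Points in the strip are called forbidden. A good path is a path from $(0,0)$ to $(kn-i,n)$ that avoids all forbidden points. Partitions: for each good path, let $p$ be the first lattice point on the path after $(0,0)$ that satisfies $d(p)\ge 0$ (such a point exists since the endpoint has $d=i\ge 0$). The path is assigned to Partition $d(p)$; so for each integer $c\ge 0$, Partition $c$ is the set of good paths with $d(p)=c$. *)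

theory Defs
  imports Main
begin

type_synonym point = "int \<times> int"

definition hdist :: "int \<Rightarrow> point \<Rightarrow> int" where
  "hdist k p = k * snd p - fst p"

definition unit_step :: "point \<Rightarrow> point \<Rightarrow> bool" where
  "unit_step p q \<longleftrightarrow> q = (fst p + 1, snd p) \<or> q = (fst p, snd p + 1)"

text \<open>A lattice path is the list of all lattice points it visits, both ends included.\<close>

definition lattice_path :: "point \<Rightarrow> point \<Rightarrow> point list \<Rightarrow> bool" where
  "lattice_path p q ps \<longleftrightarrow>
     ps \<noteq> [] \<and> hd ps = p \<and> last ps = q \<and> successively unit_step ps"

definition endpoint :: "int \<Rightarrow> int \<Rightarrow> int \<Rightarrow> point" where
  "endpoint k n i = (k * n - i, n)"

text \<open>The set \<open>B\<close> is the arbitrary choice of points on the upper boundary.\<close>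

definition is_strip :: "int \<Rightarrow> int \<Rightarrow> int \<Rightarrow> point set \<Rightarrow> bool" where
  "is_strip k n i S \<longleftrightarrow>
     (\<exists>B. B \<subseteq> {p. p \<notin> {(0, 0), endpoint k n i} \<and> hdist k p = i} \<and>
          S = {p. p \<notin> {(0, 0), endpoint k n i} \<and> 0 \<le> hdist k p \<and> hdist k p < i} \<union> B)"

definition good_paths :: "int \<Rightarrow> int \<Rightarrow> int \<Rightarrow> point set \<Rightarrow> point list set" where
  "good_paths k n i S =
     {ps. lattice_path (0, 0) (endpoint k n i) ps \<and> set ps \<inter> S = {}}"

text \<open>The starting point is the head of the list, so searching the tail gives the first
  point \<open>p\<close> after the start with \<open>hdist k p \<ge> 0\<close>.\<close>

definition path_partition ::
  "int \<Rightarrow> int \<Rightarrow> int \<Rightarrow> point set \<Rightarrow> int \<Rightarrow> point list set" where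
  "path_partition k n i S c =
     {ps \<in> good_paths k n i S.
        \<exists>p. find (\<lambda>p. 0 \<le> hdist k p) (tl ps) = Some p \<and> hdist k p = c}"

text \<open>The sets of paths involved are finite, so \<^const>\<open>card\<close> counts them.\<close>

lemma lattice_path_bounds:
  assumes "lattice_path p q ps"
  shows "int (length ps) = fst q + snd q - fst p - snd p + 1 \<and> fst p \<le> fst q \<and> snd p \<le> snd q
    \<and> set ps \<subseteq> {fst p..fst q} \<times> {snd p..snd q}"
  using assms
proof (induction ps arbitrary: p)
  case Nil
  then show ?case by (simp add: lattice_path_def)
next
  case (Cons a ps)
  show ?case
  proof (cases ps)
    case Nil
    with Cons.prems show ?thesis by (cases p) (auto simp: lattice_path_def)
  next
    case (Cons b bs)
    have ap: "a = p" and st: "unit_step p b" and lp: "lattice_path b q ps"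
      using Cons.prems Cons by (auto simp: lattice_path_def)
    show ?thesis using Cons.IH[OF lp] st ap
      by (cases p; cases b; cases q) (fastforce simp: unit_step_def)
  qed
qed

lemma finite_good_paths: "finite (good_paths k n i S)"
proof -
  let ?q = "endpoint k n i"
  have "good_paths k n i S \<subseteq>
      {ps. set ps \<subseteq> {0..fst ?q} \<times> {0..snd ?q} \<and> length ps = nat (fst ?q + snd ?q + 1)}"
    using lattice_path_bounds by (fastforce simp: good_paths_def)
  then show ?thesis
    by (rule finite_subset) (intro finite_lists_length_eq finite_cartesian_product; simp)
qed

lemma finite_path_partition: "finite (path_partition k n i S c)"
  by (rule finite_subset[OF _ finite_good_paths]) (auto simp: path_partition_def)

end

theory Submission
  imports Defs
begin

text \<open>Cut a path of Partition \<open>c\<close>, where \<open>i \<le> c < k\<close>, at its first point \<open>p\<close> after the start with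
  \<open>d(p) \<ge> 0\<close>, and rotate the initial segment from the origin to \<open>p\<close> by 180 degrees.  The rotation
  \<open>q \<mapsto> p - q\<close> changes \<open>d\<close> into \<open>c - d\<close>, so the inner points of the segment, where \<open>d < 0\<close>, are
  moved to points with \<open>d > c \<ge> i\<close>; neither kind is forbidden.  The outcome starts with an up step,
  and \<open>p\<close> is its first point after the start with \<open>d \<le> c\<close>.  Conversely every good path that
  starts with an up step, i.e. every path of Partition \<open>k\<close>, reaches \<open>d = c\<close>, as \<open>d\<close> decreases only
  by unit steps, and the same rotation leads back to Partition \<open>c\<close>.\<close>

section \<open>Cutting a path and rotating its initial segment\<close>

definition rotate_about :: "point \<Rightarrow> point \<Rightarrow> point" where
  "rotate_about p q = (fst p - fst q, snd p - snd q)"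

definition join :: "point list \<times> point \<times> point list \<Rightarrow> point list" where
  "join = (\<lambda>(as, p, bs). (0, 0) # as @ p # bs)"

text \<open>The predicate \<open>R\<close> is left open so that one notion serves both sides of the
  rotation: \<open>hdist k q < 0\<close> before it, \<open>c < hdist k q\<close> after it.\<close>

definition splits ::
  "(point \<Rightarrow> bool) \<Rightarrow> int \<Rightarrow> int \<Rightarrow> int \<Rightarrow> point set \<Rightarrow> int
     \<Rightarrow> (point list \<times> point \<times> point list) set" where
  "splits R k n i S c =
     {(as, p, bs). (\<forall>q\<in>set as. R q) \<and> hdist k p = c \<and> join (as, p, bs) \<in> good_paths k n i S}"

definition rotate_split ::
  "point list \<times> point \<times> point list \<Rightarrow> point list \<times> point \<times> point list" where
  "rotate_split = (\<lambda>(as, p, bs). (rev (map (rotate_about p) as), p, bs))"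

lemma rotate_about_involution [simp]: "rotate_about p (rotate_about p q) = q"
  by (simp add: rotate_about_def)

lemma hdist_rotate_about: "hdist k (rotate_about p q) = hdist k p - hdist k q"
  by (simp add: rotate_about_def hdist_def algebra_simps)

lemma unit_step_rotate_about:
  "unit_step (rotate_about p q) (rotate_about p r) \<longleftrightarrow> unit_step r q"
  by (cases q; cases r) (auto simp: unit_step_def rotate_about_def)

lemma rotate_split_involution: "rotate_split (rotate_split t) = t"
  by (simp add: rotate_split_def rev_map comp_def split: prod.splits)

lemma hdist_unit_step:
  assumes "unit_step p q"
  shows "hdist k q = hdist k p - 1 \<or> hdist k q = hdist k p + k"
  using assms by (auto simp: unit_step_def hdist_def algebra_simps)

lemma hdist_endpoint: "hdist k (endpoint k n i) = i"
  by (simp add: hdist_def endpoint_def)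

lemma successively_join:
  "successively unit_step (join (as, p, bs)) \<longleftrightarrow>
     successively unit_step ((0, 0) # as @ [p]) \<and> successively unit_step (p # bs)"
proof -
  have "join (as, p, bs) = ((0, 0) # as @ [p]) @ bs"
    by (simp add: join_def)
  then show ?thesis
    by (cases bs) (auto simp del: append.simps simp: successively_append_iff)
qed

text \<open>The half-turn swaps the origin with \<open>p\<close> and reverses every step, so the new
  segment is the image of the whole old one, read backwards.\<close>

lemma successively_rotate:
  assumes "successively unit_step ((0, 0) # as @ [p])"
  shows "successively unit_step ((0, 0) # rev (map (rotate_about p) as) @ [p])"
proof -
  have "(0, 0) # rev (map (rotate_about p) as) @ [p]
      = rev (map (rotate_about p) ((0, 0) # as @ [p]))"
    by (simp add: rotate_about_def)
  moreover have "successively unit_step \<dots>"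
    using assms by (simp only: successively_rev successively_map unit_step_rotate_about)
  ultimately show ?thesis
    by simp
qed

text \<open>This separates what concerns the segment before \<open>p\<close> from what concerns the
  rest; after a rotation only the former has to be checked again.\<close>

lemma join_mem_good_paths_iff:
  "join (as, p, bs) \<in> good_paths k n i S \<longleftrightarrow>
     successively unit_step ((0, 0) # as @ [p]) \<and> successively unit_step (p # bs) \<and>
     last (p # bs) = endpoint k n i \<and> insert (0, 0) (set as) \<inter> S = {} \<and> set (p # bs) \<inter> S = {}"
proof -
  have "join (as, p, bs) \<noteq> []" "hd (join (as, p, bs)) = (0, 0)"
    "last (join (as, p, bs)) = last (p # bs)"
    "set (join (as, p, bs)) = insert (0, 0) (set as) \<union> set (p # bs)"
    by (auto simp: join_def)
  then show ?thesis
    unfolding good_paths_def lattice_path_def mem_Collect_eq successively_join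
    by (simp only: Int_Un_distrib2 Un_empty simp_thms conj_ac)
qed

lemma is_strip_bounds:
  assumes "is_strip k n i S" "q \<in> S"
  shows "q \<noteq> (0, 0)" "0 \<le> i \<Longrightarrow> 0 \<le> hdist k q" "hdist k q \<le> i"
  using assms by (auto simp: is_strip_def)

text \<open>The endpoint has \<open>hdist\<close> equal to \<open>i\<close>, so the strict bound
  already keeps it away.\<close>

lemma is_strip_interior:
  assumes "is_strip k n i S" "0 \<le> hdist k q" "hdist k q < i" "q \<noteq> (0, 0)"
  shows "q \<in> S"
  using assms by (auto simp: is_strip_def hdist_endpoint)

text \<open>The cut can be read off the joined path: \<open>p\<close> violates \<open>R\<close>, so
  \<open>as\<close> is the longest prefix satisfying \<open>R\<close> after the origin.\<close>

lemma inj_on_join_splits: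
  assumes "\<And>p. hdist k p = c \<Longrightarrow> \<not> R p"
  shows "inj_on join (splits R k n i S c)"
proof (rule inj_onI)
  fix t t'
  assume *: "t \<in> splits R k n i S c" "t' \<in> splits R k n i S c" and eq: "join t = join t'"
  obtain as p bs as' p' bs' where t: "t = (as, p, bs)" "t' = (as', p', bs')"
    by (cases t; cases t')
  have "takeWhile R (as @ p # bs) = as" "takeWhile R (as' @ p' # bs') = as'"
    using * assms by (auto simp: t splits_def takeWhile_tail)
  moreover have "as @ p # bs = as' @ p' # bs'"
    using eq by (simp add: t join_def)
  ultimately show "t = t'"
    by (auto simp: t)
qed

text \<open>Both directions of the bijection are instances. The condition \<open>R'\<close> speaks
  of the value of \<open>hdist\<close>, which the rotation turns into \<open>c - hdist k q\<close>;
  its values lie outside the range \<open>0..i\<close> of the strip.\<close>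

lemma rotate_split_mem_splits:
  assumes "is_strip k n i S" and "t \<in> splits R k n i S c"
    and "\<And>q. R q \<Longrightarrow> R' (c - hdist k q)"
    and "\<And>d. R' d \<Longrightarrow> d < 0 \<or> i < d" and "0 \<le> i"
  shows "rotate_split t \<in> splits (\<lambda>q. R' (hdist k q)) k n i S c"
proof -
  obtain as p bs where t: "t = (as, p, bs)"
    by (cases t)
  have as: "\<forall>q\<in>set as. R q" and p: "hdist k p = c" and
    good: "join (as, p, bs) \<in> good_paths k n i S"
    using assms(2) by (auto simp: splits_def t)
  have R': "R' (hdist k q)" if "q \<in> rotate_about p ` set as" for q
    using that as assms(3) p by (auto simp: hdist_rotate_about)
  have "q \<notin> S" if "q \<in> rotate_about p ` set as" for q
    using R'[OF that] assms(4) is_strip_bounds[OF assms(1), of q] assms(5) by fastforce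
  then have "join (rev (map (rotate_about p) as), p, bs) \<in> good_paths k n i S"
    using good unfolding join_mem_good_paths_iff by (auto intro: successively_rotate)
  then show ?thesis
    using R' p by (simp add: t rotate_split_def splits_def)
qed

lemma card_splits_rotate:
  assumes "is_strip k n i S" "0 \<le> i" "i \<le> c"
  shows "card (splits (\<lambda>q. hdist k q < 0) k n i S c) = card (splits (\<lambda>q. c < hdist k q) k n i S c)"
proof (rule bij_betw_same_card)
  show "bij_betw rotate_split (splits (\<lambda>q. hdist k q < 0) k n i S c)
      (splits (\<lambda>q. c < hdist k q) k n i S c)"
  \<comment> \<open>The map is its own inverse. The hypothesis \<open>i \<le> c\<close> places
    points with \<open>c < hdist k q\<close> beyond the strip.\<close>
  proof (rule bij_betw_byWitness[where f' = rotate_split])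
    show "rotate_split ` splits (\<lambda>q. hdist k q < 0) k n i S c
        \<subseteq> splits (\<lambda>q. c < hdist k q) k n i S c"
      using assms
      by (auto intro!: rotate_split_mem_splits[where R' = "\<lambda>d. c < d", OF assms(1)])
    show "rotate_split ` splits (\<lambda>q. c < hdist k q) k n i S c
        \<subseteq> splits (\<lambda>q. hdist k q < 0) k n i S c"
      using assms
      by (auto intro!: rotate_split_mem_splits[where R' = "\<lambda>d. d < 0", OF assms(1)])
  qed (simp_all add: rotate_split_involution)
qed

section \<open>Partitions described by cut paths\<close>

lemma find_append_Cons:
  assumes "\<forall>x\<in>set xs. \<not> P x" "P y"
  shows "find P (xs @ y # ys) = Some y"
  using assms by (induction xs) auto

lemma find_SomeE:
  assumes "find P xs = Some y"
  obtains us vs where "xs = us @ y # vs" "P y" "\<forall>x\<in>set us. \<not> P x"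
proof -
  have "\<exists>us vs. xs = us @ y # vs \<and> P y \<and> (\<forall>x\<in>set us. \<not> P x)"
    using assms
  proof (induction xs)
    case (Cons x xs)
    show ?case
    proof (cases "P x")
      case True
      with Cons.prems show ?thesis
        by (intro exI[of _ "[]"] exI[of _ xs]) auto
    next
      case False
      with Cons obtain us vs where "xs = us @ y # vs" "P y" "\<forall>x\<in>set us. \<not> P x"
        by auto
      with False show ?thesis
        by (intro exI[of _ "x # us"] exI[of _ vs]) auto
    qed
  qed simp
  then show thesis
    using that by blast
qed

lemma path_partition_eq_join_splits:
  assumes "0 \<le> c"
  shows "path_partition k n i S c = join ` splits (\<lambda>q. hdist k q < 0) k n i S c"
proof (intro set_eqI iffI)
  fix ps
  assume ps: "ps \<in> path_partition k n i S c"
  then obtain p where good: "ps \<in> good_paths k n i S" and p: "hdist k p = c"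
    and f: "find (\<lambda>p. 0 \<le> hdist k p) (tl ps) = Some p"
    by (auto simp: path_partition_def)
  obtain as bs where tl: "tl ps = as @ p # bs" and as: "\<forall>q\<in>set as. \<not> 0 \<le> hdist k q"
    using f by (rule find_SomeE)
  have "ps = join (as, p, bs)"
    using good tl by (cases ps) (auto simp: good_paths_def lattice_path_def join_def)
  moreover from this have "(as, p, bs) \<in> splits (\<lambda>q. hdist k q < 0) k n i S c"
    using good as p by (auto simp: splits_def)
  ultimately show "ps \<in> join ` splits (\<lambda>q. hdist k q < 0) k n i S c"
    by blast
next
  fix ps
  assume "ps \<in> join ` splits (\<lambda>q. hdist k q < 0) k n i S c"
  then obtain as p bs where "(as, p, bs) \<in> splits (\<lambda>q. hdist k q < 0) k n i S c"
    and ps: "ps = join (as, p, bs)"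
    by auto
  then have as: "\<forall>q\<in>set as. hdist k q < 0" and p: "hdist k p = c" and
    good: "join (as, p, bs) \<in> good_paths k n i S"
    by (auto simp: splits_def)
  \<comment> \<open>As \<open>0 \<le> c\<close>, the search stops at \<open>p\<close>
    itself.\<close>
  have "find (\<lambda>p. 0 \<le> hdist k p) (as @ p # bs) = Some p"
    using as p assms by (intro find_append_Cons) auto
  then show "ps \<in> path_partition k n i S c"
    using good p ps by (cases p) (simp add: path_partition_def join_def)
qed

text \<open>A discrete intermediate value argument: a step that lowers \<open>hdist\<close> lowers
  it by exactly one, so the first value not above \<open>c\<close> equals \<open>c\<close>.\<close>

lemma first_descent:
  assumes "successively unit_step qs" "qs \<noteq> []" "c < hdist k (hd qs)" "hdist k (last qs) \<le> c"
    and "0 < k"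
  shows "\<exists>as p bs. qs = as @ p # bs \<and> (\<forall>q\<in>set as. c < hdist k q) \<and> hdist k p = c"
  using assms(1-4)
proof (induction qs)
  case (Cons q qs)
  then have "qs \<noteq> []"
    by auto
  then have step: "unit_step q (hd qs)" and succ: "successively unit_step qs"
    using Cons.prems(1) by (cases qs; simp)+
  show ?case
  proof (cases "c < hdist k (hd qs)")
    case True
    then obtain as p bs where "qs = as @ p # bs" "\<forall>q\<in>set as. c < hdist k q" "hdist k p = c"
      using Cons.IH Cons.prems succ \<open>qs \<noteq> []\<close> by auto
    then show ?thesis
      using Cons.prems(3) by (intro exI[of _ "q # as"] exI[of _ p] exI[of _ bs]) auto
  next
    case False
    then have "hdist k (hd qs) = c"
      using hdist_unit_step[OF step, of k] Cons.prems(3) \<open>0 < k\<close> by auto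
    then show ?thesis
      using Cons.prems(3) \<open>qs \<noteq> []\<close>
      by (intro exI[of _ "[q]"] exI[of _ "hd qs"] exI[of _ "tl qs"]) auto
  qed
qed simp

text \<open>A step raises \<open>hdist\<close> by at most \<open>k\<close>, so from a negative value
  it cannot reach \<open>k\<close>. The point found must therefore come directly after the
  origin.\<close>

lemma path_partition_top_eq:
  assumes "0 < k"
  shows "path_partition k n i S k = {ps \<in> good_paths k n i S. \<exists>bs. ps = (0, 0) # (0, 1) # bs}"
proof (intro set_eqI iffI)
  fix ps
  assume "ps \<in> path_partition k n i S k"
  then obtain as p bs where "(as, p, bs) \<in> splits (\<lambda>q. hdist k q < 0) k n i S k"
    and ps: "ps = join (as, p, bs)"
    using assms by (auto simp: path_partition_eq_join_splits)
  then have as: "\<forall>q\<in>set as. hdist k q < 0" and p: "hdist k p = k" and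
    good: "join (as, p, bs) \<in> good_paths k n i S"
    by (auto simp: splits_def)
  have step: "unit_step (last ((0, 0) # as)) p"
    using good unfolding join_mem_good_paths_iff append_Cons[symmetric] successively_append_iff
    by simp
  have "as = []"
  proof (rule ccontr)
    assume "as \<noteq> []"
    then have "hdist k (last as) < 0"
      using as by auto
    then show False
      using hdist_unit_step[OF step, of k] \<open>as \<noteq> []\<close> p assms by auto
  qed
  moreover from this have "p = (0, 1)"
    using step p assms by (auto simp: unit_step_def hdist_def)
  ultimately show "ps \<in> {ps \<in> good_paths k n i S. \<exists>bs. ps = (0, 0) # (0, 1) # bs}"
    using good ps by (simp add: join_def)
next
  fix ps
  assume "ps \<in> {ps \<in> good_paths k n i S. \<exists>bs. ps = (0, 0) # (0, 1) # bs}"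
  then show "ps \<in> path_partition k n i S k"
    using assms by (auto simp: path_partition_def hdist_def)
qed

lemma path_partition_top_eq_join_splits:
  assumes "0 < k" "0 \<le> i" "i \<le> c" "c < k"
  shows "path_partition k n i S k = join ` splits (\<lambda>q. c < hdist k q) k n i S c"
proof (intro set_eqI iffI)
  fix ps
  assume "ps \<in> path_partition k n i S k"
  then obtain bs where good: "ps \<in> good_paths k n i S" and ps: "ps = (0, 0) # (0, 1) # bs"
    using assms by (auto simp: path_partition_top_eq)
  have succ: "successively unit_step ((0, 1) # bs)" and
    last: "last ((0, 1) # bs) = endpoint k n i"
    using good by (simp_all add: ps good_paths_def lattice_path_def)
  \<comment> \<open>The descent runs from \<open>(0, 1)\<close>, where \<open>hdist\<close> is
    \<open>k > c\<close>, to the endpoint, where it is \<open>i \<le> c\<close>.\<close>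
  obtain as p bs' where *: "(0, 1) # bs = as @ p # bs'" "\<forall>q\<in>set as. c < hdist k q" "hdist k p = c"
    using first_descent[OF succ, of c k] assms last
    by (auto simp: hdist_endpoint) (auto simp: hdist_def)
  then have "ps = join (as, p, bs')"
    by (simp add: ps join_def)
  moreover from this have "(as, p, bs') \<in> splits (\<lambda>q. c < hdist k q) k n i S c"
    using good * by (auto simp: splits_def)
  ultimately show "ps \<in> join ` splits (\<lambda>q. c < hdist k q) k n i S c"
    by blast
next
  fix ps
  assume "ps \<in> join ` splits (\<lambda>q. c < hdist k q) k n i S c"
  then obtain as p bs where "(as, p, bs) \<in> splits (\<lambda>q. c < hdist k q) k n i S c"
    and ps: "ps = join (as, p, bs)"
    by auto
  then have as: "\<forall>q\<in>set as. c < hdist k q" and p: "hdist k p = c" and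
    good: "ps \<in> good_paths k n i S"
    by (auto simp: splits_def)
  obtain q qs where qs: "as @ p # bs = q # qs"
    by (cases as) auto
  \<comment> \<open>The bound is weak because \<open>as\<close> may be empty at this stage. It
    suffices: a right step from the origin would give the value -1, below \<open>c\<close>.\<close>
  then have "c \<le> hdist k q"
    using as p by (cases as) auto
  moreover have "unit_step (0, 0) q"
    using good by (simp add: ps join_def qs good_paths_def lattice_path_def)
  ultimately have "q = (0, 1)"
    using assms by (auto simp: unit_step_def hdist_def)
  then show "ps \<in> path_partition k n i S k"
    using good ps qs assms by (auto simp: path_partition_top_eq join_def)
qed

lemma card_path_partition_eq_top:
  assumes "is_strip k n i S" "0 < k" "0 \<le> i" "i \<le> c" "c \<le> k"
  shows "card (path_partition k n i S c) = card (path_partition k n i S k)"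
proof (cases "c = k")
  case False
  have "card (path_partition k n i S c) = card (splits (\<lambda>q. hdist k q < 0) k n i S c)"
    using assms by (simp add: path_partition_eq_join_splits card_image inj_on_join_splits)
  also have "\<dots> = card (splits (\<lambda>q. c < hdist k q) k n i S c)"
    using assms by (intro card_splits_rotate)
  also have "\<dots> = card (path_partition k n i S k)"
    using assms False
    by (simp add: path_partition_top_eq_join_splits[of k i c] card_image inj_on_join_splits)
  finally show ?thesis .
qed simp

section \<open>Which partitions are non-empty\<close>

lemma successively_map_upto:
  assumes "\<And>x. a \<le> x \<Longrightarrow> x < b \<Longrightarrow> P (f x) (f (x + 1))"
  shows "successively P (map f [a..b])"
  using assms
proof (induction a b rule: upto.induct)
  case (1 a b)
  show ?case
  proof (cases "a < b")
    case True
    then have "[a..b] = a # [a + 1..b]" "[a + 1..b] = (a + 1) # [a + 1 + 1..b]"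
      by (simp_all only: upto_rec1[of a] upto_rec1[of "a + 1"] zless_imp_add1_zle less_imp_le)
    moreover have "successively P (map f [a + 1..b])"
      using 1 True by simp
    moreover have "P (f a) (f (a + 1))"
      using 1(2)[of a] True by simp
    ultimately show ?thesis
      by (simp only: list.map successively.simps)
  next
    case False
    then show ?thesis
      by (cases "a = b") auto
  qed
qed

text \<open>The witness goes straight up to height \<open>n\<close> and then straight right; apart
  from its two ends it stays where \<open>hdist\<close> exceeds \<open>i\<close>.\<close>

lemma path_partition_top_nonempty:
  assumes "is_strip k n i S" "0 < k" "0 < n" "0 \<le> i" "i < k"
  shows "path_partition k n i S k \<noteq> {}"
proof -
  define m where "m = k * n - i"
  \<comment> \<open>The second range starts at 1, so that the corner \<open>(0, n)\<close> is listed
    once. It is non-empty because \<open>k * n \<ge> k > i\<close>.\<close>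
  define ps :: "point list" where "ps = map (Pair 0) [0..n] @ map (\<lambda>x. (x, n)) [1..m]"
  have "k * 1 \<le> k * n"
    using assms by (intro mult_left_mono) auto
  then have m: "0 < m"
    unfolding m_def using assms by linarith
  have "ps = (0, 0) # (0, 1) # map (Pair 0) [2..n] @ map (\<lambda>x. (x, n)) [1..m]"
    using assms by (simp add: ps_def upto_rec1)
  moreover have "ps \<in> good_paths k n i S"
  proof -
    have "last ps = endpoint k n i"
      using m by (simp add: ps_def upto_rec2 endpoint_def m_def[symmetric])
    moreover have "ps \<noteq> []" "hd ps = (0, 0)"
      using assms by (simp_all add: ps_def upto_rec1)
    moreover have "successively unit_step ps"
    proof -
      have "successively unit_step (map (Pair 0) [0..n])"
        "successively unit_step (map (\<lambda>x. (x, n)) [1..m])"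
        by (rule successively_map_upto; simp add: unit_step_def)+
      moreover have "last (map (Pair 0) [0..n]) = (0 :: int, n)" "hd (map (\<lambda>x. (x, n)) [1..m]) = (1, n)"
        using assms m by (simp_all add: upto_rec2[of 0 n] upto_rec1[of 1 m])
      ultimately show ?thesis
        unfolding ps_def successively_append_iff by (simp only: unit_step_def) simp
    qed
    moreover have "q \<notin> S" if "q \<in> set ps" for q
    proof
      assume "q \<in> S"
      from is_strip_bounds[OF assms(1) this]
      have q: "q \<noteq> (0, 0)" "hdist k q \<le> i"
        by auto
      \<comment> \<open>On the vertical part \<open>q\<close> is not the origin, so
        \<open>hdist\<close> is at least \<open>k > i\<close>. On the horizontal part
        \<open>hdist\<close> is at least \<open>i\<close>, with equality only at the endpoint, which
        no strip contains.\<close>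
      from that consider y where "q = (0, y)" "0 \<le> y" | x where "q = (x, n)" "x \<le> m"
        by (auto simp: ps_def)
      then show False
      proof cases
        case 1
        then have "k * 1 \<le> k * y"
          using q assms by (intro mult_left_mono) auto
        then show False
          using q(2) assms(5) unfolding 1 hdist_def fst_conv snd_conv by linarith
      next
        case 2
        then have "q = endpoint k n i"
          using q by (simp add: hdist_def m_def endpoint_def)
        then show False
          using \<open>q \<in> S\<close> assms(1) by (auto simp: is_strip_def)
      qed
    qed
    ultimately show ?thesis
      by (auto simp: good_paths_def lattice_path_def)
  qed
  ultimately show ?thesis
    using assms by (auto simp: path_partition_top_eq)
qed

text \<open>The point \<open>p\<close> is entered from a value at most 0, hence
  \<open>c \<le> k\<close>. Being neither forbidden nor the origin, it cannot have a value in
  \<open>0..<i\<close>, hence \<open>i \<le> c\<close>.\<close>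

lemma path_partition_nonempty_bounds:
  assumes "is_strip k n i S" "0 < k" "0 \<le> c" "path_partition k n i S c \<noteq> {}"
  shows "i \<le> c" "c \<le> k"
proof -
  obtain as p bs where "(as, p, bs) \<in> splits (\<lambda>q. hdist k q < 0) k n i S c"
    using assms by (fastforce simp: path_partition_eq_join_splits)
  then have as: "\<forall>q\<in>set as. hdist k q < 0" and p: "hdist k p = c" and
    good: "join (as, p, bs) \<in> good_paths k n i S"
    by (auto simp: splits_def)
  have "p \<notin> S" and succ: "successively unit_step ((0, 0) # as @ [p])"
    using good unfolding join_mem_good_paths_iff by auto
  from succ have step: "unit_step (last ((0, 0) # as)) p"
    unfolding append_Cons[symmetric] successively_append_iff by simp
  \<comment> \<open>Equality covers the case of empty \<open>as\<close>, when \<open>p\<close>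
    follows the origin.\<close>
  have "hdist k (last ((0, 0) # as)) \<le> 0"
    using as by (auto simp: hdist_def less_imp_le)
  then show "c \<le> k"
    using hdist_unit_step[OF step, of k] assms(2) p by auto
  have "lattice_path (0, 0) p ((0, 0) # as @ [p])"
    using succ by (simp add: lattice_path_def)
  \<comment> \<open>The length of a path determines the sum of the coordinates of its end; here
    there are at least two points, so that sum is positive.\<close>
  from lattice_path_bounds[OF this] have "p \<noteq> (0, 0)"
    by auto
  with \<open>p \<notin> S\<close> show "i \<le> c"
    using is_strip_interior[OF assms(1), of p] p assms(3) by force
qed

theorem theorem4:
  fixes k n i :: int and S :: "point set"
  assumes "0 < k" and "0 < n" and "0 \<le> i" and "i < k"
    and "is_strip k n i S"
  shows "{c. 0 \<le> c \<and> path_partition k n i S c \<noteq> {}} = {i..k} \<and>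
    (\<forall>a\<in>{i..k}. \<forall>b\<in>{i..k}.
       card (path_partition k n i S a) = card (path_partition k n i S b))"
proof -
  have eq: "card (path_partition k n i S c) = card (path_partition k n i S k)" if "c \<in> {i..k}" for c
    using that assms by (intro card_path_partition_eq_top) auto
  \<comment> \<open>By finiteness, non-emptiness becomes a non-zero count, which the equal counts
    pass on to all of \<open>{i..k}\<close>.\<close>
  have "card (path_partition k n i S k) \<noteq> 0"
    using path_partition_top_nonempty assms by (simp add: finite_path_partition)
  then have "path_partition k n i S c \<noteq> {}" if "c \<in> {i..k}" for c
    using eq[OF that] by auto
  moreover have "c \<in> {i..k}" if "0 \<le> c" "path_partition k n i S c \<noteq> {}" for c
    using path_partition_nonempty_bounds[OF assms(5,1) that] by simp
  moreover have "0 \<le> c" if "c \<in> {i..k}" for c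
    using that assms(3) by simp
  ultimately have "{c. 0 \<le> c \<and> path_partition k n i S c \<noteq> {}} = {i..k}"
    by blast
  then show ?thesis
    using eq by metis
qed

end
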